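(* Let $\ell\ge1$, let $\mathcal A$ be a finite alphabet, and let $F$ be a PCA with alphabet $\mathcal A$, neighborhood $\{0,\ldots,\ell\}$ and transition probabilities $\theta^k_{x_0\cdots x_\ell}$. Let $p=(p_i)_{i\in\mathcal A}$ be a probability vector with $p_i>0$ for all $i$ such that both following conditions hold: $$\forall x_0,\ldots,x_{\ell-1}\in\mathcal A,\ \forall k\in\mathcal A,\quad \sum_{i\in\mathcal A}p_i\,\theta^k_{x_0\cdots x_{\ell-1}i}=p_k\quad\text{and}\quad\sum_{i\in\mathcal A}p_i\,\theta^k_{i\,x_0\cdots x_{\ell-1}}=p_k.$$ Then every line of the stationary space-time diagram $(X^n_k)_{k,n\in\mathbb Z}$ of $F$ associated with $\mu_p$ consists of i.i.d. random variables: for every straight line $L\subset\mathbb R^2$, the variables $(X^n_k)_{(k,n)\in L\cap\mathbb Z^2}$ are i.i.d. In particular, any two different variables $X^n_k$ and $X^{n'}_{k'}$, $(k,n)\neq(k',n')$, are independent.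
   Context: A PCA with alphabet $\mathcal A$ and neighborhood $\{0,\ldots,\ell\}$ is given by transition probabilities $\theta^k_{x_0\cdots x_\ell}\ge0$ with $\sum_{k\in\mathcal A}\theta^k_{x_0\cdots x_\ell}=1$: the new value of cell $j\in\mathbb Z$ equals $k$ with probability $\theta^k_{x_0\cdots x_\ell}$ when the current values of cells $j,\ldots,j+\ell$ are $x_0,\ldots,x_\ell$, independently for different cells. $\mu_p$ is the product measure on $\mathcal A^{\mathbb Z}$ in which each coordinate equals $i$ with probability $p_i$; under the displayed conditions it is invariant for the PCA. The stationary space-time diagram associated with $\mu_p$ is the random field $(X^n_k)_{k,n\in\mathbb Z}$ such that, for every $n$, $X^n=(X^n_k)_{k\in\mathbb Z}\sim\mu_p$ and, given $(X^m)_{m\le n}$, the variables $(X^{n+1}_j)_{j\in\mathbb Z}$ are independent, with $X^{n+1}_j$ equal to $k$ with probability $\theta^k_{X^n_j\cdots X^n_{j+\ell}}$. *)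

theory Defs
  imports "HOL-Probability.Probability"
begin

text \<open>The alphabet is a finite type. A word \<open>x\<^sub>0 \<dots> x\<^sub>m\<close> is a list; \<open>\<theta> k w\<close> stands for
  the transition probability with upper index \<open>k\<close> and lower index \<open>w\<close>, and only its values on
  words \<open>w\<close> of length \<open>l + 1\<close> matter.\<close>

definition is_pca :: "nat \<Rightarrow> ('a::finite \<Rightarrow> 'a list \<Rightarrow> real) \<Rightarrow> bool" where
  "is_pca l \<theta> \<longleftrightarrow>
     (\<forall>w. length w = Suc l \<longrightarrow> (\<forall>k. 0 \<le> \<theta> k w) \<and> (\<Sum>k\<in>UNIV. \<theta> k w) = 1)"

definition neighborhood_word :: "nat \<Rightarrow> (int \<Rightarrow> 'a) \<Rightarrow> int \<Rightarrow> 'a list" where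
  "neighborhood_word l x j = map (\<lambda>i. x (j + int i)) [0..<Suc l]"

definition mu :: "('a::finite \<Rightarrow> real) \<Rightarrow> (int \<Rightarrow> 'a) measure" where
  "mu p = (\<Pi>\<^sub>M j\<in>UNIV. point_measure UNIV (\<lambda>i. ennreal (p i)))"

text \<open>In \<open>X n k\<close> the first argument is time and the second one is space.\<close>

definition past_algebra :: "'w measure \<Rightarrow> (int \<Rightarrow> int \<Rightarrow> 'w \<Rightarrow> 'a) \<Rightarrow> int \<Rightarrow> 'w measure" where
  "past_algebra M X n = sigma (space M) {X m j -` B \<inter> space M | m j B. m \<le> n}"

definition conditional_prob :: "'w measure \<Rightarrow> 'w measure \<Rightarrow> 'w set \<Rightarrow> 'w \<Rightarrow> real" where
  "conditional_prob M G A = real_cond_exp M G (indicator A)"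

text \<open>The last two conjuncts say that, given the past up to time \<open>n\<close>, the cells at time
  \<open>n + 1\<close> are conditionally independent and follow the transition probabilities.\<close>

definition stationary_space_time_diagram ::
    "nat \<Rightarrow> ('a::finite \<Rightarrow> 'a list \<Rightarrow> real) \<Rightarrow> ('a \<Rightarrow> real) \<Rightarrow>
     'w measure \<Rightarrow> (int \<Rightarrow> int \<Rightarrow> 'w \<Rightarrow> 'a) \<Rightarrow> bool" where
  "stationary_space_time_diagram l \<theta> p M X \<longleftrightarrow>
     prob_space M \<and>
     (\<forall>n k. X n k \<in> measurable M (count_space UNIV)) \<and>
     (\<forall>n. distr M (\<Pi>\<^sub>M j\<in>UNIV. count_space UNIV) (\<lambda>\<omega> j. X n j \<omega>) = mu p) \<and>
     (\<forall>n J B. finite J \<longrightarrow>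
        (AE \<omega> in M.
           conditional_prob M (past_algebra M X n) {\<omega> \<in> space M. \<forall>j\<in>J. X (n + 1) j \<omega> \<in> B j} \<omega>
           = (\<Prod>j\<in>J. conditional_prob M (past_algebra M X n)
                         {\<omega> \<in> space M. X (n + 1) j \<omega> \<in> B j} \<omega>))) \<and>
     (\<forall>n j k.
        AE \<omega> in M.
          conditional_prob M (past_algebra M X n) {\<omega> \<in> space M. X (n + 1) j \<omega> = k} \<omega>
          = \<theta> k (neighborhood_word l (\<lambda>i. X n i \<omega>) j))"

definition iid_vars :: "'w measure \<Rightarrow> 'b measure \<Rightarrow> ('i \<Rightarrow> 'w \<Rightarrow> 'b) \<Rightarrow> 'i set \<Rightarrow> bool" where
  "iid_vars M N Y I \<longleftrightarrow>
     prob_space.indep_vars M (\<lambda>_. N) Y I \<and>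
     (\<forall>i\<in>I. \<forall>j\<in>I. distr M N (Y i) = distr M N (Y j))"

definition straight_line :: "(real \<times> real) set \<Rightarrow> bool" where
  "straight_line L \<longleftrightarrow> affine L \<and> aff_dim L = 1"

end

theory Submission
  imports Defs
begin

text \<open>
  The two averaging conditions make the field invisible from one side. Only finitely many cells
  matter at a time, so one may start from the earliest row concerned, which is i.i.d. with law
  \<open>p\<close>, and reveal the diagram from right to left. The value of cell \<open>(k, n + 1)\<close> is drawn from
  the word at cells \<open>(k, n), \<dots>, (k + l, n)\<close>; if everything strictly to the right of column
  \<open>k\<close> is known and \<open>X n k\<close> has law \<open>p\<close> given that knowledge, then the condition that averages
  over the first letter says that \<open>X (n + 1) k\<close> has law \<open>p\<close> given it as well. The columns to the right evolve
  without looking at column \<open>k\<close>, so knowing their future does not change this. Hence each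
  \<open>X n k\<close> has law \<open>p\<close> and is independent of all cells in columns beyond \<open>k\<close>, at all times.
  When a line that is not vertical is revealed column by column, every one of its cells is therefore
  fresh, and the line is i.i.d.

  A vertical line meets a single column, and here the other condition does the same job. It averages
  over the last letter of the word, and the cells \<open>(k + l, n)\<close> and \<open>(k, n + 1)\<close> have the same
  value of \<open>k + l n\<close>, whereas the other letters of the word lie at smaller values. So \<open>X n k\<close> is
  independent of all cells at which \<open>k + l n\<close> is smaller, and along a vertical line
  \<open>k + l n\<close> is injective since \<open>l \<ge> 1\<close>.

  Both arguments are one argument about a \<^emph>\<open>height\<close> \<open>h\<close> on cells: one letter of each word has
  the height of the new cell, all others are lower, and averaging over that one letter with weights
  \<open>p\<close> returns \<open>p\<close> (locale \<open>height_function\<close>). Lemma \<open>ev_resample_above\<close> shows that a cell may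
  then be replaced by an independent draw from \<open>p\<close> in any expectation over it and finitely many
  lower cells, and \<open>ev_prod\<close> iterates this from the highest cell downwards.
\<close>

section \<open>Observables of finitely many cells\<close>

definition depends_on :: "(('c \<Rightarrow> 'a) \<Rightarrow> real) \<Rightarrow> 'c set \<Rightarrow> bool" where
  "depends_on g C \<longleftrightarrow> (\<forall>x x'. (\<forall>c\<in>C. x c = x' c) \<longrightarrow> g x = g x')"

text \<open>Integrates the cell \<open>c\<close> out of the observable \<open>g\<close> against the law \<open>q x\<close>, which may depend
  on the configuration. Two instances matter: \<open>q\<close> constantly \<open>p\<close>, and \<open>q\<close> the law of a cell given
  the word from which it is drawn. That the expectation of \<open>g\<close> is unchanged by it, for all \<open>g\<close> on a given
  set of cells, says that \<open>q\<close> is the conditional law of cell \<open>c\<close> given the others.\<close>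
definition resample ::
    "(('c \<Rightarrow> 'a::finite) \<Rightarrow> 'a \<Rightarrow> real) \<Rightarrow> 'c \<Rightarrow> (('c \<Rightarrow> 'a) \<Rightarrow> real) \<Rightarrow> ('c \<Rightarrow> 'a) \<Rightarrow> real" where
  "resample q c g x = (\<Sum>v\<in>UNIV. q x v * g (x(c := v)))"

definition cylinder :: "'c set \<Rightarrow> ('c \<Rightarrow> 'a) \<Rightarrow> ('c \<Rightarrow> 'a) \<Rightarrow> real" where
  "cylinder C y x = (\<Prod>c\<in>C. of_bool (x c = y c))"

lemma depends_onI: "(\<And>x x'. (\<And>c. c \<in> C \<Longrightarrow> x c = x' c) \<Longrightarrow> g x = g x') \<Longrightarrow> depends_on g C"
  unfolding depends_on_def by blast

lemma depends_onD: "depends_on g C \<Longrightarrow> (\<And>c. c \<in> C \<Longrightarrow> x c = x' c) \<Longrightarrow> g x = g x'"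
  unfolding depends_on_def by blast

lemma depends_on_mono: "depends_on g C \<Longrightarrow> C \<subseteq> D \<Longrightarrow> depends_on g D"
  unfolding depends_on_def by blast

lemma depends_on_mult:
  "depends_on f C \<Longrightarrow> depends_on g D \<Longrightarrow> depends_on (\<lambda>x. f x * g x) (C \<union> D)"
  by (intro depends_onI arg_cong2[where f = "(*)"]) (blast intro: depends_onD)+

lemma depends_on_prod:
  "(\<And>i. i \<in> I \<Longrightarrow> depends_on (f i) C) \<Longrightarrow> depends_on (\<lambda>x. \<Prod>i\<in>I. f i x) C"
  by (intro depends_onI prod.cong) (blast intro: depends_onD)+

lemma depends_on_cylinder: "depends_on (cylinder C y) C"
  unfolding cylinder_def by (intro depends_onI prod.cong) auto

lemma depends_on_upd: "depends_on g (insert c C) \<Longrightarrow> depends_on (\<lambda>x. g (x(c := v))) C"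
  by (rule depends_onI) (auto intro: depends_onD)

lemma depends_on_resample:
  assumes "depends_on g (insert c C)" and "\<And>v. depends_on (\<lambda>x. q x v) D"
  shows "depends_on (resample q c g) (C \<union> D)"
  unfolding resample_def
proof (intro depends_onI sum.cong refl arg_cong2[where f = "(*)"])
  fix x x' :: "'a \<Rightarrow> 'b" and v
  assume *: "\<And>c. c \<in> C \<union> D \<Longrightarrow> x c = x' c"
  show "q x v = q x' v" by (rule depends_onD[OF assms(2)]) (use * in auto)
  show "g (x(c := v)) = g (x'(c := v))" by (rule depends_onD[OF assms(1)]) (use * in auto)
qed

text \<open>Integrations over two different cells can be exchanged as soon as neither law looks at the cell that
  the other one replaces. This lets a cell be resampled from \<open>p\<close> past the evolution of cells that do not
  depend on it.\<close>
lemma resample_commute: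
  assumes "c \<noteq> d" and "\<And>x v. q (x(d := v)) = q x" and "\<And>x v. r (x(c := v)) = r x"
  shows "resample q c (resample r d g) = resample r d (resample q c g)"
proof
  fix x
  have "resample q c (resample r d g) x
      = (\<Sum>v\<in>UNIV. \<Sum>u\<in>UNIV. q x v * (r x u * g (x(c := v, d := u))))"
    unfolding resample_def assms(3) by (simp add: sum_distrib_left)
  also have "\<dots> = (\<Sum>u\<in>UNIV. \<Sum>v\<in>UNIV. r x u * (q x v * g (x(d := u, c := v))))"
    by (subst sum.swap) (simp add: fun_upd_twist[OF assms(1)] mult.left_commute)
  also have "\<dots> = resample r d (resample q c g) x"
    unfolding resample_def assms(2) by (simp add: sum_distrib_left)
  finally show "resample q c (resample r d g) x = resample r d (resample q c g) x" .
qed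

text \<open>The alphabet is finite, so an observable of finitely many cells is a finite linear combination
  of cylinders. All statements about expectations are thereby reduced to products of
  indicators, the only observables for which the hypotheses on the diagram speak.\<close>
lemma cylinder_expansion:
  fixes g :: "('c \<Rightarrow> 'a::finite) \<Rightarrow> real"
  assumes "finite C" and "depends_on g C"
  shows "g x = (\<Sum>y\<in>C \<rightarrow>\<^sub>E UNIV. g y * cylinder C y x)"
proof -
  have zero: "cylinder C y x = 0" if "y \<in> C \<rightarrow>\<^sub>E UNIV" "y \<noteq> restrict x C" for y
  proof -
    from that obtain c where "c \<in> C" "x c \<noteq> y c"
      by (metis PiE_restrict restrict_ext)
    then show ?thesis using \<open>finite C\<close> unfolding cylinder_def by (auto intro!: prod_zero)
  qed
  have "(\<Sum>y\<in>C \<rightarrow>\<^sub>E UNIV. g y * cylinder C y x)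
      = (\<Sum>y\<in>{restrict x C}. g y * cylinder C y x)"
    by (rule sum.mono_neutral_right) (use \<open>finite C\<close> zero in \<open>auto intro!: finite_PiE\<close>)
  also have "\<dots> = g (restrict x C)" by (simp add: cylinder_def)
  also have "\<dots> = g x" by (rule depends_onD[OF assms(2)]) simp
  finally show ?thesis ..
qed

section \<open>Expectations in a space-time diagram\<close>

text \<open>A cell is a pair of space and time. The law of a cell is read off from the word one time step
  earlier.\<close>
definition local_law ::
    "nat \<Rightarrow> ('a \<Rightarrow> 'a list \<Rightarrow> real) \<Rightarrow> int \<times> int \<Rightarrow> (int \<times> int \<Rightarrow> 'a) \<Rightarrow> 'a \<Rightarrow> real" where
  "local_law l \<theta> c x v = \<theta> v (map (\<lambda>i. x (fst c + int i, snd c - 1)) [0..<Suc l])"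

definition parents :: "nat \<Rightarrow> int \<times> int \<Rightarrow> (int \<times> int) set" where
  "parents l c = (\<lambda>i. (fst c + int i, snd c - 1)) ` {..l}"

lemma finite_parents [simp]: "finite (parents l c)"
  by (simp add: parents_def)

lemma snd_parents: "d \<in> parents l c \<Longrightarrow> snd d = snd c - 1"
  by (auto simp: parents_def)

lemma depends_on_local_law: "depends_on (\<lambda>x. local_law l \<theta> c x v) (parents l c)"
  unfolding local_law_def parents_def
  by (intro depends_onI arg_cong[where f = "\<theta> v"] map_cong) auto

lemma local_law_upd: "d \<notin> parents l c \<Longrightarrow> local_law l \<theta> c (x(d := u)) = local_law l \<theta> c x"
  by (intro ext depends_onD[OF depends_on_local_law]) auto

locale space_time_diagram = prob_space M
  for M :: "'w measure"
    and l :: nat and \<theta> :: "'a::finite \<Rightarrow> 'a list \<Rightarrow> real" and p :: "'a \<Rightarrow> real"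
    and X :: "int \<Rightarrow> int \<Rightarrow> 'w \<Rightarrow> 'a" +
  assumes p_pos: "\<And>i. p i > 0" and p_sum: "(\<Sum>i\<in>UNIV. p i) = 1"
    and diagram: "stationary_space_time_diagram l \<theta> p M X"
begin

definition field :: "'w \<Rightarrow> int \<times> int \<Rightarrow> 'a" where
  "field \<omega> c = X (snd c) (fst c) \<omega>"

definition ev :: "((int \<times> int \<Rightarrow> 'a) \<Rightarrow> real) \<Rightarrow> real" where
  "ev g = (\<integral>\<omega>. g (field \<omega>) \<partial>M)"

abbreviation law :: "int \<times> int \<Rightarrow> (int \<times> int \<Rightarrow> 'a) \<Rightarrow> 'a \<Rightarrow> real" where
  "law \<equiv> local_law l \<theta>"

lemma X_measurable [measurable]: "X n k \<in> measurable M (count_space UNIV)"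
  using diagram by (simp add: stationary_space_time_diagram_def)

lemma row_independent:
  assumes "finite J"
  shows "AE \<omega> in M. conditional_prob M (past_algebra M X n) {\<omega> \<in> space M. \<forall>j\<in>J. X (n + 1) j \<omega> \<in> B j} \<omega>
       = (\<Prod>j\<in>J. conditional_prob M (past_algebra M X n) {\<omega> \<in> space M. X (n + 1) j \<omega> \<in> B j} \<omega>)"
  using diagram[unfolded stationary_space_time_diagram_def, THEN conjunct2, THEN conjunct2,
      THEN conjunct2, THEN conjunct1, THEN spec[of _ n], THEN spec[of _ J], THEN spec[of _ B]] assms
  by (rule mp)

lemma cell_law:
  "AE \<omega> in M. conditional_prob M (past_algebra M X n) {\<omega> \<in> space M. X (n + 1) j \<omega> = k} \<omega>
     = \<theta> k (neighborhood_word l (\<lambda>i. X n i \<omega>) j)"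
  using diagram[unfolded stationary_space_time_diagram_def, THEN conjunct2, THEN conjunct2,
      THEN conjunct2, THEN conjunct2, THEN spec[of _ n], THEN spec[of _ j], THEN spec[of _ k]]
  .

lemma subalgebra_past: "subalgebra M (past_algebra M X n)"
proof -
  have *: "{X m j -` B \<inter> space M | m j B. m \<le> n} \<subseteq> sets M"
    by (auto intro!: measurable_sets[OF X_measurable])
  moreover have "{X m j -` B \<inter> space M | m j B. m \<le> n} \<subseteq> Pow (space M)"
    by auto
  ultimately show ?thesis
    unfolding subalgebra_def past_algebra_def
    by (simp add: space_measure_of_conv sets.sigma_sets_subset)
qed

lemma X_measurable_past:
  assumes "m \<le> n"
  shows "X m j \<in> measurable (past_algebra M X n) (count_space UNIV)"
proof (rule measurableI)
  fix A :: "'a set"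
  have "{X m j -` B \<inter> space M | m j B. m \<le> n} \<subseteq> Pow (space M)" by auto
  then show "X m j -` A \<inter> space (past_algebra M X n) \<in> sets (past_algebra M X n)"
    using assms unfolding past_algebra_def by (auto simp: space_measure_of_conv intro!: sigma_sets.Basic)
qed simp

lemma measurable_past:
  assumes "finite C" and "\<And>c. c \<in> C \<Longrightarrow> snd c \<le> n" and "depends_on g C"
  shows "(\<lambda>\<omega>. g (field \<omega>)) \<in> borel_measurable (past_algebra M X n)"
proof -
  have "(\<lambda>\<omega>. of_bool (field \<omega> c = v) :: real) \<in> borel_measurable (past_algebra M X n)"
    if "c \<in> C" for c v
    unfolding field_def
    by (rule measurable_compose[OF X_measurable_past[OF assms(2)[OF that]]]) simp
  then have "(\<lambda>\<omega>. \<Sum>y\<in>C \<rightarrow>\<^sub>E UNIV. g y * cylinder C y (field \<omega>))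
      \<in> borel_measurable (past_algebra M X n)"
    unfolding cylinder_def
    by (intro borel_measurable_sum borel_measurable_times borel_measurable_const
        borel_measurable_prod)
  then show ?thesis
    by (simp add: cylinder_expansion[OF assms(1,3), symmetric])
qed

lemma integrable_observable:
  assumes "finite C" and "depends_on g C"
  shows "integrable M (\<lambda>\<omega>. g (field \<omega>))"
proof (rule integrable_const_bound)
  define n where "n = Max (insert 0 (snd ` C))"
  have "\<And>c. c \<in> C \<Longrightarrow> snd c \<le> n" using assms(1) by (simp add: n_def)
  from measurable_past[OF assms(1) this assms(2)]
  show "(\<lambda>\<omega>. g (field \<omega>)) \<in> borel_measurable M"
    by (rule measurable_from_subalg[OF subalgebra_past])
  have "norm (g x) \<le> (\<Sum>y\<in>C \<rightarrow>\<^sub>E UNIV. \<bar>g y\<bar>)" for x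
  proof -
    have "\<bar>cylinder C y x\<bar> \<le> 1" for y
      unfolding cylinder_def abs_prod by (rule prod_le_1) auto
    then have "\<bar>g y * cylinder C y x\<bar> \<le> \<bar>g y\<bar>" for y
      by (simp add: abs_mult mult_left_le)
    then have "\<bar>\<Sum>y\<in>C \<rightarrow>\<^sub>E UNIV. g y * cylinder C y x\<bar> \<le> (\<Sum>y\<in>C \<rightarrow>\<^sub>E UNIV. \<bar>g y\<bar>)"
      by (intro order.trans[OF sum_abs] sum_mono)
    then show ?thesis
      by (simp add: cylinder_expansion[OF assms, symmetric])
  qed
  then show "AE \<omega> in M. norm (g (field \<omega>)) \<le> (\<Sum>y\<in>C \<rightarrow>\<^sub>E UNIV. \<bar>g y\<bar>)" by simp
qed

lemma ev_sum_scaled: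
  assumes "\<And>i. i \<in> I \<Longrightarrow> finite (C i)" and "\<And>i. i \<in> I \<Longrightarrow> depends_on (f i) (C i)"
  shows "ev (\<lambda>x. \<Sum>i\<in>I. a i * f i x) = (\<Sum>i\<in>I. a i * ev (f i))"
  unfolding ev_def
  by (subst Bochner_Integration.integral_sum)
     (use integrable_observable[OF assms] in \<open>auto intro!: integrable_mult_right\<close>)

text \<open>The criterion for \<open>q\<close> to be the conditional law of cell \<open>c\<close> given the cells \<open>C\<close>. Both sides
  are linear in \<open>g\<close>: the left one expands like the right one, with the point mass at the present value of \<open>c\<close>
  in place of \<open>q\<close>.\<close>
lemma ev_resample_from_cylinders:
  assumes "finite C" and "depends_on g (insert c C)"
    and "finite D" and q: "\<And>v. depends_on (\<lambda>x. q x v) D"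
    and cyl: "\<And>y v. ev (\<lambda>x. cylinder C y x * of_bool (x c = v)) = ev (\<lambda>x. cylinder C y x * q x v)"
  shows "ev g = ev (resample q c g)"
proof -
  define I :: "('a \<times> (int \<times> int \<Rightarrow> 'a)) set" where "I = UNIV \<times> (C \<rightarrow>\<^sub>E UNIV)"
  have expand: "(\<Sum>v\<in>UNIV. r v * g (x(c := v)))
      = (\<Sum>(v, y)\<in>I. g (y(c := v)) * (cylinder C y x * r v))" for r x
  proof -
    have "g (x(c := v)) = (\<Sum>y\<in>C \<rightarrow>\<^sub>E UNIV. g (y(c := v)) * cylinder C y x)" for v
      by (rule cylinder_expansion[OF assms(1) depends_on_upd[OF assms(2)]])
    then show ?thesis
      unfolding I_def by (simp add: sum.cartesian_product[symmetric] sum_distrib_left mult_ac)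
  qed
  have dirac: "g x = (\<Sum>v\<in>UNIV. of_bool (x c = v) * g (x(c := v)))" for x
    by (simp add: of_bool_def if_distrib[of "\<lambda>a. a * _"] cong: if_cong)
  have d1: "depends_on (\<lambda>x. cylinder C y x * of_bool (x c = v)) (C \<union> {c})" for y v
    by (intro depends_on_mult depends_on_cylinder depends_onI) simp
  have d2: "depends_on (\<lambda>x. cylinder C y x * q x v) (C \<union> D)" for y v
    by (intro depends_on_mult depends_on_cylinder q)
  have "ev g = ev (\<lambda>x. \<Sum>i\<in>I. g ((snd i)(c := fst i)) * (cylinder C (snd i) x * of_bool (x c = fst i)))"
    by (rule arg_cong[where f = ev], rule ext, subst dirac) (simp only: expand case_prod_unfold)
  also have "\<dots> = (\<Sum>i\<in>I. g ((snd i)(c := fst i)) * ev (\<lambda>x. cylinder C (snd i) x * of_bool (x c = fst i)))"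
    by (rule ev_sum_scaled[where C = "\<lambda>_. C \<union> {c}"]) (use assms(1) d1 in auto)
  also have "\<dots> = (\<Sum>i\<in>I. g ((snd i)(c := fst i)) * ev (\<lambda>x. cylinder C (snd i) x * q x (fst i)))"
    by (simp add: cyl)
  also have "\<dots> = ev (\<lambda>x. \<Sum>i\<in>I. g ((snd i)(c := fst i)) * (cylinder C (snd i) x * q x (fst i)))"
    by (rule ev_sum_scaled[symmetric, where C = "\<lambda>_. C \<union> D"]) (use assms(1,3) d2 in auto)
  also have "\<dots> = ev (resample q c g)"
    unfolding resample_def by (subst expand) (simp add: case_prod_unfold)
  finally show ?thesis .
qed

lemma indicator_row_event:
  assumes "finite J" and "\<omega> \<in> space M"
  shows "indicator {\<omega> \<in> space M. \<forall>j\<in>J. X n j \<omega> \<in> {y j}} \<omega>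
       = (\<Prod>j\<in>J. of_bool (field \<omega> (j, n) = y j) :: real)"
  using assms by (auto simp: field_def indicator_def intro!: prod_zero)

lemma row_event_measurable:
  assumes "finite J"
  shows "{\<omega> \<in> space M. \<forall>j\<in>J. X n j \<omega> \<in> {y j}} \<in> sets M"
  using assms by measurable

text \<open>The defining property of the diagram in terms of expectations: conditionally on the past,
  a row is a product of the local laws, so against an observable \<open>W\<close> of the past the indicator of
  letters in the row may be traded for the product of their local laws.\<close>
lemma ev_row_step:
  assumes "finite C" and "\<And>c. c \<in> C \<Longrightarrow> snd c < n" and "depends_on W C" and "finite J"
  shows "ev (\<lambda>x. W x * (\<Prod>j\<in>J. of_bool (x (j, n) = y j)))
       = ev (\<lambda>x. W x * (\<Prod>j\<in>J. law (j, n) x (y j)))"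
proof -
  let ?G = "past_algebra M X (n - 1)"
  let ?A = "{\<omega> \<in> space M. \<forall>j\<in>J. X n j \<omega> \<in> {y j}}"
  interpret finite_measure_subalgebra M ?G
    by unfold_locales (rule subalgebra_past)
  have A: "?A \<in> sets M" by (rule row_event_measurable[OF \<open>finite J\<close>])
  have W: "(\<lambda>\<omega>. W (field \<omega>)) \<in> borel_measurable ?G"
    by (rule measurable_past[OF assms(1) _ assms(3)]) (use assms(2) in force)
  have "ev (\<lambda>x. W x * (\<Prod>j\<in>J. of_bool (x (j, n) = y j)))
      = (\<integral>\<omega>. W (field \<omega>) * indicator ?A \<omega> \<partial>M)"
    unfolding ev_def
    by (intro Bochner_Integration.integral_cong refl) (simp only: indicator_row_event[OF \<open>finite J\<close>])
  also have "\<dots> = (\<integral>\<omega>. W (field \<omega>) * real_cond_exp M ?G (indicator ?A) \<omega> \<partial>M)"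
    by (rule real_cond_exp_intg(2)[symmetric])
       (use A W in \<open>auto intro!: integrable_real_mult_indicator integrable_observable[OF assms(1,3)]\<close>)
  also have "\<dots> = ev (\<lambda>x. W x * (\<Prod>j\<in>J. law (j, n) x (y j)))"
    unfolding ev_def
  proof (rule integral_cong_AE)
    have "AE \<omega> in M. conditional_prob M ?G {\<omega> \<in> space M. X n j \<omega> = y j} \<omega>
        = law (j, n) (field \<omega>) (y j)" for j
    proof -
      have "AE \<omega> in M. conditional_prob M (past_algebra M X (n - 1)) {\<omega> \<in> space M. X (n - 1 + 1) j \<omega> = y j} \<omega>
        = \<theta> (y j) (neighborhood_word l (\<lambda>i. X (n - 1) i \<omega>) j)"
        by (rule cell_law)
      then show ?thesis by (simp add: local_law_def neighborhood_word_def field_def)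
    qed
    then have law: "AE \<omega> in M. \<forall>j\<in>J. conditional_prob M ?G {\<omega> \<in> space M. X n j \<omega> = y j} \<omega>
        = law (j, n) (field \<omega>) (y j)"
      using \<open>finite J\<close> by (simp add: AE_finite_all)
    have "AE \<omega> in M. conditional_prob M (past_algebra M X (n - 1))
            {\<omega> \<in> space M. \<forall>j\<in>J. X (n - 1 + 1) j \<omega> \<in> {y j}} \<omega>
         = (\<Prod>j\<in>J. conditional_prob M (past_algebra M X (n - 1))
                       {\<omega> \<in> space M. X (n - 1 + 1) j \<omega> \<in> {y j}} \<omega>)"
      by (rule row_independent[OF \<open>finite J\<close>])
    with law show "AE \<omega> in M. W (field \<omega>) * real_cond_exp M ?G (indicator ?A) \<omega>
        = W (field \<omega>) * (\<Prod>j\<in>J. law (j, n) (field \<omega>) (y j))"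
      by eventually_elim (simp add: conditional_prob_def)
    show "(\<lambda>\<omega>. W (field \<omega>) * real_cond_exp M ?G (indicator ?A) \<omega>) \<in> borel_measurable M"
      using measurable_from_subalg[OF subalgebra_past W] by measurable
    have "depends_on (\<lambda>x. W x * (\<Prod>j\<in>J. law (j, n) x (y j))) (C \<union> (\<Union>j\<in>J. parents l (j, n)))"
      by (intro depends_on_mult assms(3) depends_on_prod
          depends_on_mono[OF depends_on_local_law]) auto
    then show "(\<lambda>\<omega>. W (field \<omega>) * (\<Prod>j\<in>J. law (j, n) (field \<omega>) (y j))) \<in> borel_measurable M"
      by (intro borel_measurable_integrable)
         (erule integrable_observable[rotated], use assms(1,4) in auto)
  qed
  finally show ?thesis .
qed

text \<open>The Markov property for a single cell, with other cells of the same row among the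
  known ones. The indicators of those other cells are traded for their laws together with the one of
  \<open>c\<close>, and then traded back with the law of \<open>c\<close> counted as part of the past.\<close>
lemma ev_resample_law:
  assumes "finite C" and "\<And>d. d \<in> C \<Longrightarrow> snd d \<le> snd c" and "c \<notin> C"
    and "depends_on g (insert c C)"
  shows "ev g = ev (resample (law c) c g)"
proof (rule ev_resample_from_cylinders[OF assms(1,4) finite_parents depends_on_local_law])
  fix y :: "int \<times> int \<Rightarrow> 'a" and v :: 'a
  obtain k n where c: "c = (k, n)" by (cases c)
  define J where "J = {j. (j, n) \<in> C}"
  define C' where "C' = {d \<in> C. snd d < n}"
  define y' where "y' j = (if j = k then v else y (j, n))" for j
  have J: "finite J" "k \<notin> J"
    using finite_vimageI[OF assms(1), of "\<lambda>j. (j, n)"] assms(3)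
    by (auto simp: J_def c vimage_def inj_on_def)
  have C': "finite C'" "\<And>d. d \<in> C' \<Longrightarrow> snd d < n" using assms(1) by (auto simp: C'_def)
  have split: "C = C' \<union> (\<lambda>j. (j, n)) ` J" "C' \<inter> (\<lambda>j. (j, n)) ` J = {}"
    using assms(2) by (force simp: C'_def J_def c)+
  have cyl: "cylinder C y x = cylinder C' y x * (\<Prod>j\<in>J. of_bool (x (j, n) = y' j))" for x
  proof -
    have "cylinder C y x = cylinder C' y x * (\<Prod>d\<in>(\<lambda>j. (j, n)) ` J. of_bool (x d = y d))"
      unfolding cylinder_def by (subst split(1), rule prod.union_disjoint) (use C' J split(2) in auto)
    also have "(\<Prod>d\<in>(\<lambda>j. (j, n)) ` J. of_bool (x d = y d)) = (\<Prod>j\<in>J. of_bool (x (j, n) = y' j) :: real)"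
      using J(2) by (subst prod.reindex) (auto simp: inj_on_def y'_def intro!: prod.cong)
    finally show ?thesis .
  qed
  have y'k: "y' k = v" by (simp add: y'_def)
  have dW: "depends_on (\<lambda>x. cylinder C' y x * law (k, n) x v) (C' \<union> parents l (k, n))"
    by (intro depends_on_mult depends_on_cylinder depends_on_local_law)
  have "ev (\<lambda>x. cylinder C y x * of_bool (x c = v))
      = ev (\<lambda>x. cylinder C' y x * (\<Prod>j\<in>insert k J. of_bool (x (j, n) = y' j)))"
    using J by (simp add: cyl c y'k mult_ac)
  also have "\<dots> = ev (\<lambda>x. cylinder C' y x * (\<Prod>j\<in>insert k J. law (j, n) x (y' j)))"
    using J by (intro ev_row_step[OF C' depends_on_cylinder]) auto
  also have "\<dots> = ev (\<lambda>x. (cylinder C' y x * law (k, n) x v) * (\<Prod>j\<in>J. law (j, n) x (y' j)))"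
    using J by (simp add: y'k mult_ac)
  also have "\<dots> = ev (\<lambda>x. (cylinder C' y x * law (k, n) x v) * (\<Prod>j\<in>J. of_bool (x (j, n) = y' j)))"
    by (rule ev_row_step[OF _ _ dW J(1), symmetric]) (use C' in \<open>auto dest: snd_parents\<close>)
  also have "\<dots> = ev (\<lambda>x. cylinder C y x * law c x v)"
    by (simp add: cyl c mult_ac)
  finally show "ev (\<lambda>x. cylinder C y x * of_bool (x c = v)) = ev (\<lambda>x. cylinder C y x * law c x v)" .
qed

lemma ev_row_cylinder:
  assumes "finite J"
  shows "ev (\<lambda>x. \<Prod>j\<in>J. of_bool (x (j, n) = y j)) = (\<Prod>j\<in>J. p (y j))"
proof -
  let ?S = "\<Pi>\<^sub>M j\<in>(UNIV :: int set). count_space (UNIV :: 'a set)"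
  let ?N = "\<lambda>_ :: int. point_measure (UNIV :: 'a set) (\<lambda>i. ennreal (p i))"
  let ?A = "{\<omega> \<in> space M. \<forall>j\<in>J. X n j \<omega> \<in> {y j}}"
  let ?E = "prod_emb UNIV ?N J (\<Pi>\<^sub>E j\<in>J. {y j})"
  have p0: "0 \<le> p i" for i using p_pos[of i] by simp
  have N: "prob_space (?N j)" for j
    by (intro prob_spaceI) (simp add: emeasure_point_measure_finite space_point_measure p0 p_sum)
  have E: "?E = {f. \<forall>j\<in>J. f j = y j}"
    by (auto simp: prod_emb_def space_PiM space_point_measure PiE_iff extensional_def)
  have sets: "?E \<in> sets ?S"
    using sets_PiM_I[OF assms subset_UNIV, of "\<lambda>j. {y j}" ?N]
    by (subst sets_PiM_cong[OF refl, of _ _ ?N]) (simp_all add: sets_point_measure)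
  have "ev (\<lambda>x. \<Prod>j\<in>J. of_bool (x (j, n) = y j)) = (\<integral>\<omega>. indicator ?A \<omega> \<partial>M)"
    unfolding ev_def
    by (intro Bochner_Integration.integral_cong refl) (simp only: indicator_row_event[OF assms])
  also have "\<dots> = measure M ?A"
    using row_event_measurable[OF assms] by simp
  also have "\<dots> = measure (distr M ?S (\<lambda>\<omega> j. X n j \<omega>)) ?E"
  proof (subst measure_distr[OF _ sets])
    show "(\<lambda>\<omega> j. X n j \<omega>) \<in> measurable M ?S"
      by (rule measurable_PiM_single') auto
    show "measure M ?A = measure M ((\<lambda>\<omega> j. X n j \<omega>) -` ?E \<inter> space M)"
      unfolding E by (intro arg_cong[where f = "measure M"]) auto
  qed
  also have "\<dots> = measure (mu p) ?E"
    using diagram by (simp add: stationary_space_time_diagram_def)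
  also have "emeasure (mu p) ?E = (\<Prod>j\<in>J. ennreal (p (y j)))"
    unfolding mu_def
    by (subst emeasure_PiM_emb[OF N _ assms])
       (auto simp: sets_point_measure emeasure_point_measure_finite)
  then have "measure (mu p) ?E = (\<Prod>j\<in>J. p (y j))"
    by (simp add: measure_def prod_ennreal p0 prod_nonneg)
  finally show ?thesis .
qed

lemma ev_resample_row:
  assumes "finite C" and "\<And>d. d \<in> C \<Longrightarrow> snd d = snd c" and "c \<notin> C"
    and "depends_on g (insert c C)"
  shows "ev g = ev (resample (\<lambda>_. p) c g)"
proof (rule ev_resample_from_cylinders[OF assms(1,4), of "{}"])
  fix y :: "int \<times> int \<Rightarrow> 'a" and v :: 'a
  obtain k n where c: "c = (k, n)" by (cases c)
  define J where "J = fst ` C"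
  define y' where "y' j = (if j = k then v else y (j, n))" for j
  have C: "C = (\<lambda>j. (j, n)) ` J" using assms(2) by (force simp: J_def c image_image)
  have J: "finite J" "k \<notin> J" using assms by (force simp: J_def c)+
  have cyl: "cylinder C y x = (\<Prod>j\<in>J. of_bool (x (j, n) = y' j))" for x
    using J(2) unfolding cylinder_def C
    by (subst prod.reindex) (auto simp: inj_on_def y'_def intro!: prod.cong)
  have y'k: "y' k = v" by (simp add: y'_def)
  have "ev (\<lambda>x. cylinder C y x * of_bool (x c = v))
      = ev (\<lambda>x. \<Prod>j\<in>insert k J. of_bool (x (j, n) = y' j))"
    using J by (simp add: cyl c y'k mult_ac)
  also have "\<dots> = (\<Prod>j\<in>J. p (y' j)) * p v"
    by (subst ev_row_cylinder) (use J in \<open>simp_all add: y'k\<close>)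
  also have "\<dots> = ev (\<lambda>x. cylinder C y x) * p v"
    by (simp add: cyl ev_row_cylinder[OF J(1)])
  also have "\<dots> = ev (\<lambda>x. cylinder C y x * p v)"
    by (simp add: ev_def)
  finally show "ev (\<lambda>x. cylinder C y x * of_bool (x c = v)) = ev (\<lambda>x. cylinder C y x * p v)" .
qed (auto intro: depends_onI)

end

section \<open>Height functions\<close>

text \<open>The case of interest is \<open>e \<le> l\<close>. Among the cells \<open>(k, n - 1), \<dots>, (k + l, n - 1)\<close> from
  which cell \<open>(k, n)\<close> is drawn, the one with offset \<open>e\<close> is then at the same height and the others
  are strictly lower. Consequently the cells below a given height evolve among themselves, while a
  cell at that height and its successive level neighbours form a chain in time driven by them.
  Here \<open>average\<close> states that \<open>p\<close> is stationary for this chain, whatever the lower letters are.\<close>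
locale height_function = space_time_diagram M l \<theta> p X
  for M :: "'w measure"
    and l :: nat and \<theta> :: "'a::finite \<Rightarrow> 'a list \<Rightarrow> real" and p :: "'a \<Rightarrow> real"
    and X :: "int \<Rightarrow> int \<Rightarrow> 'w \<Rightarrow> 'a" +
  fixes h :: "int \<times> int \<Rightarrow> int" and e :: nat
  assumes height_level: "\<And>k n. h (k + int e, n - 1) = h (k, n)"
    and height_below: "\<And>k n i. i \<le> l \<Longrightarrow> i \<noteq> e \<Longrightarrow> h (k + int i, n - 1) < h (k, n)"
    and average: "\<And>w v. length w = Suc l \<Longrightarrow> (\<Sum>u\<in>UNIV. p u * \<theta> v (w[e := u])) = p v"
begin

lemma height_parents: "d \<in> parents l c \<Longrightarrow> h d \<le> h c"
  using height_level[of "fst c" "snd c"] height_below[of _ "fst c" "snd c"]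
  by (force simp: parents_def)

lemma average_law:
  "(\<Sum>u\<in>UNIV. p u * law (k, n) (x((k + int e, n - 1) := u)) v) = p v"
proof -
  let ?w = "map (\<lambda>i. x (k + int i, n - 1)) [0..<Suc l]"
  have "law (k, n) (x((k + int e, n - 1) := u)) v = \<theta> v (?w[e := u])" for u
    unfolding local_law_def
    by (rule arg_cong[where f = "\<theta> v"])
       (auto simp: list_eq_iff_nth_eq nth_list_update simp del: upt_Suc)
  then show ?thesis using average[of ?w v] by simp
qed

text \<open>Induction on the last time \<open>n0 + t\<close> that is looked at. In the row at time \<open>n0\<close> the claim is that
  the row is i.i.d. Later, the known cells of the last row are first integrated out one by one
  against their local laws: they are lower than \<open>c\<close>, hence so are all cells they are drawn from, and
  their laws do not see \<open>c\<close>. If \<open>c\<close> itself lies in the last row, its local law replaces it next. It then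
  depends on the cell \<open>c'\<close> of the same height one step earlier and on lower cells; the induction
  hypothesis puts an independent draw from \<open>p\<close> at \<open>c'\<close>, and averaging over it turns the
  law of \<open>c\<close> into \<open>p\<close>.\<close>
lemma ev_resample_bounded:
  assumes "finite C" and "\<And>d. d \<in> C \<Longrightarrow> h d < h c \<and> n0 \<le> snd d \<and> snd d \<le> n0 + int t"
    and "n0 \<le> snd c" and "snd c \<le> n0 + int t" and "depends_on g (insert c C)"
  shows "ev g = ev (resample (\<lambda>_. p) c g)"
  using assms
proof (induction t arbitrary: C c g)
  case 0
  have "c \<notin> C" using 0(2) by blast
  with 0 show ?case by (intro ev_resample_row[of C]) force+
next
  case (Suc t)
  define T where "T = n0 + int (Suc t)"
  from Suc.prems show ?case
  proof (induction "card {d \<in> C. snd d = T}" arbitrary: C g)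
    case 0
    then have below: "snd d \<le> n0 + int t" if "d \<in> C" for d
    proof -
      have "{d \<in> C. snd d = T} = {}" using 0(1,2) by simp
      then have "snd d \<noteq> T" using that by blast
      then show ?thesis using 0(3)[OF that] by (simp add: T_def)
    qed
    show ?case
    proof (cases "snd c = T")
      case False
      then show ?thesis using 0 below by (intro Suc.IH[of C]) (auto simp: T_def)
    next
      case True
      obtain k n where c: "c = (k, n)" by (cases c)
      let ?c' = "(k + int e, n - 1)"
      let ?g' = "resample (law c) c g"
      let ?D = "parents l c - {?c'}"
      have level: "h ?c' = h c" by (simp add: c height_level)
      have D: "h d < h ?c'" if "d \<in> ?D" for d
        using that height_below[of _ k n] unfolding level by (auto simp: parents_def c)
      have dg': "depends_on ?g' (insert ?c' (C \<union> ?D))"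
        by (rule depends_on_mono[OF depends_on_resample[OF 0(6) depends_on_local_law]]) auto
      have "c \<notin> C" using 0(3)[of c] by blast
      then have "ev g = ev ?g'"
        using 0 below True by (intro ev_resample_law[of C]) (force simp: T_def)+
      also have "\<dots> = ev (resample (\<lambda>_. p) ?c' ?g')"
      proof (rule Suc.IH[OF _ _ _ _ dg'])
        show "finite (C \<union> ?D)" using 0(2) by simp
        show "h d < h ?c' \<and> n0 \<le> snd d \<and> snd d \<le> n0 + int t" if "d \<in> C \<union> ?D" for d
          using that 0(3)[of d] below[of d] D[of d] snd_parents[of d l c] True
          by (auto simp: level T_def)
        show "n0 \<le> snd ?c'" "snd ?c' \<le> n0 + int t" using True by (auto simp: c T_def)
      qed
      also have "resample (\<lambda>_. p) ?c' ?g' = resample (\<lambda>_. p) c g"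
      proof
        fix x
        \<comment> \<open>\<open>c'\<close> is not among the known cells, which are strictly lower than it.\<close>
        have g: "g (x(?c' := u, c := v)) = g (x(c := v))" for u v
          by (rule depends_onD[OF 0(6)]) (use 0(3)[of ?c'] level in auto)
        have "resample (\<lambda>_. p) ?c' ?g' x
            = (\<Sum>u\<in>UNIV. \<Sum>v\<in>UNIV. (p u * law c (x(?c' := u)) v) * g (x(c := v)))"
          unfolding resample_def g by (simp add: sum_distrib_left mult_ac)
        also have "\<dots> = (\<Sum>v\<in>UNIV. (\<Sum>u\<in>UNIV. p u * law c (x(?c' := u)) v) * g (x(c := v)))"
          by (subst sum.swap) (simp add: sum_distrib_right)
        also have "\<dots> = resample (\<lambda>_. p) c g x"
          unfolding c average_law resample_def ..
        finally show "resample (\<lambda>_. p) ?c' ?g' x = resample (\<lambda>_. p) c g x" .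
      qed
      finally show ?thesis .
    qed
  next
    case (Suc m)
    then obtain d where d: "d \<in> C" "snd d = T"
      by (metis (mono_tags, lifting) card.empty empty_Collect_eq nat.distinct(1))
    \<comment> \<open>Remove one known cell \<open>d\<close> from the last row, at the price of the earlier cells that
      determine its law.\<close>
    let ?C = "C - {d} \<union> parents l d"
    let ?g = "resample (law d) d"
    have hd: "h d < h c" "d \<noteq> c" using Suc(4)[OF d(1)] by auto
    have dep: "depends_on g (insert d (insert c (C - {d})))"
      by (rule depends_on_mono[OF Suc(7)]) auto
    have deps: "depends_on (?g g) (insert c ?C)"
      by (rule depends_on_mono[OF depends_on_resample[OF dep depends_on_local_law]]) auto
    have dep_p: "depends_on (resample (\<lambda>_. p) c g) (insert d (C - {d}))"
      by (rule depends_on_mono[OF depends_on_resample[of g c C _ "{}"]])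
         (use Suc(7) in \<open>auto intro: depends_onI\<close>)
    have c: "c \<notin> parents l d" using height_parents[of c d] hd by auto
    have fin: "finite C" by fact
    have "ev g = ev (?g g)"
      by (rule ev_resample_law[OF _ _ _ dep])
         (use Suc(3-6) d hd in \<open>auto simp: T_def\<close>)
    also have "\<dots> = ev (resample (\<lambda>_. p) c (?g g))"
    proof (rule Suc(1)[OF _ _ _ Suc(5,6) deps])
      have "{d' \<in> ?C. snd d' = T} = {d' \<in> C. snd d' = T} - {d}"
        using d by (auto dest: snd_parents)
      then show "m = card {d' \<in> ?C. snd d' = T}"
        using Suc(2) d fin by (simp add: card_Diff_singleton)
      show "finite ?C" using fin by simp
      show "h d' < h c \<and> n0 \<le> snd d' \<and> snd d' \<le> n0 + int (Suc t)" if "d' \<in> ?C" for d'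
        using that Suc(4)[of d'] snd_parents[of d' l d] height_parents[of d' d] hd d
        by (auto simp: T_def)
    qed
    also have "\<dots> = ev (?g (resample (\<lambda>_. p) c g))"
      by (subst resample_commute) (use hd c in \<open>auto simp: local_law_upd\<close>)
    also have "\<dots> = ev (resample (\<lambda>_. p) c g)"
      by (rule ev_resample_law[OF _ _ _ dep_p, symmetric])
         (use Suc(4) d fin in \<open>auto simp: T_def\<close>)
    finally show ?case .
  qed
qed

lemma ev_resample_above:
  assumes "finite C" and "\<And>d. d \<in> C \<Longrightarrow> h d < h c" and "depends_on g (insert c C)"
  shows "ev g = ev (resample (\<lambda>_. p) c g)"
proof -
  let ?S = "snd ` insert c C"
  have fin: "finite ?S" using assms(1) by simp
  have "Min ?S \<le> snd d \<and> snd d \<le> Min ?S + int (nat (Max ?S - Min ?S))"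
    if "d \<in> insert c C" for d
    using Min_le[OF fin imageI[OF that]] Max_ge[OF fin imageI[OF that]] by linarith
  then show ?thesis
    using assms by (intro ev_resample_bounded[of C c "Min ?S" "nat (Max ?S - Min ?S)"]) auto
qed

lemma ev_prod:
  assumes "finite S" and "inj_on h S"
  shows "ev (\<lambda>x. \<Prod>c\<in>S. f c (x c)) = (\<Prod>c\<in>S. \<Sum>v\<in>UNIV. p v * f c v)"
  using assms
proof (induction "card S" arbitrary: S)
  case 0
  then show ?case by (simp add: ev_def prob_space)
next
  case (Suc m)
  then have "finite (h ` S)" "h ` S \<noteq> {}" by auto
  from Max_in[OF this] obtain c where c: "c \<in> S" "h c = Max (h ` S)" by auto
  define R where "R = S - {c}"
  have S: "S = insert c R" "c \<notin> R" and R: "finite R" "inj_on h R" "m = card R"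
    using c Suc by (auto simp: R_def intro: inj_on_diff)
  have below: "h d < h c" if "d \<in> R" for d
  proof -
    have "h d \<le> h c" using that c Max_ge[OF \<open>finite (h ` S)\<close>] by (simp add: R_def)
    moreover have "h d \<noteq> h c" using that Suc(4) c by (auto simp: R_def inj_on_def)
    ultimately show ?thesis by simp
  qed
  let ?g = "\<lambda>x. \<Prod>c\<in>S. f c (x c)"
  have "depends_on ?g (insert c R)"
    unfolding S(1) by (intro depends_onI prod.cong) auto
  then have "ev ?g = ev (resample (\<lambda>_. p) c ?g)"
    by (intro ev_resample_above[of R] R below)
  also have "resample (\<lambda>_. p) c ?g = (\<lambda>x. (\<Sum>v\<in>UNIV. p v * f c v) * (\<Prod>d\<in>R. f d (x d)))"
  proof
    fix x
    have upd: "?g (x(c := v)) = f c v * (\<Prod>d\<in>R. f d (x d))" for v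
      unfolding S(1) using S(2) R(1) by (auto intro!: prod.cong)
    show "resample (\<lambda>_. p) c ?g x = (\<Sum>v\<in>UNIV. p v * f c v) * (\<Prod>d\<in>R. f d (x d))"
      unfolding resample_def upd by (simp add: sum_distrib_right mult.assoc)
  qed
  also have "ev \<dots> = (\<Sum>v\<in>UNIV. p v * f c v) * ev (\<lambda>x. \<Prod>d\<in>R. f d (x d))"
    by (simp add: ev_def)
  also have "\<dots> = (\<Prod>c\<in>S. \<Sum>v\<in>UNIV. p v * f c v)"
    unfolding Suc(1)[OF R(3,1,2)] S(1) using S(2) R(1) by simp
  finally show ?case .
qed

lemma prob_cells:
  assumes "finite S" and "inj_on h S"
  shows "prob {\<omega> \<in> space M. \<forall>c\<in>S. field \<omega> c \<in> B c} = (\<Prod>c\<in>S. \<Sum>v\<in>B c. p v)"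
proof -
  have sets: "{\<omega> \<in> space M. \<forall>c\<in>S. field \<omega> c \<in> B c} \<in> events"
    unfolding field_def using assms(1) by measurable
  have "prob {\<omega> \<in> space M. \<forall>c\<in>S. field \<omega> c \<in> B c}
      = (\<integral>\<omega>. indicator {\<omega> \<in> space M. \<forall>c\<in>S. field \<omega> c \<in> B c} \<omega> \<partial>M)"
    using sets by simp
  also have "\<dots> = ev (\<lambda>x. \<Prod>c\<in>S. of_bool (x c \<in> B c))"
    unfolding ev_def using assms(1)
    by (intro Bochner_Integration.integral_cong refl) (auto simp: indicator_def intro!: prod_zero)
  also have "\<dots> = (\<Prod>c\<in>S. \<Sum>v\<in>UNIV. p v * of_bool (v \<in> B c))"
    by (rule ev_prod[OF assms])
  also have "\<dots> = (\<Prod>c\<in>S. \<Sum>v\<in>B c. p v)"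
    by (intro prod.cong refl sum.mono_neutral_cong_right) auto
  finally show ?thesis .
qed

lemma iid_on_injective_heights:
  assumes "inj_on h I"
  shows "iid_vars M (count_space UNIV) (\<lambda>(k, n). X n k) I"
proof -
  have Y: "(case c of (k, n) \<Rightarrow> X n k) = (\<lambda>\<omega>. field \<omega> c)" for c
    by (auto simp: field_def split: prod.split)
  have meas: "(\<lambda>\<omega>. field \<omega> c) \<in> measurable M (count_space UNIV)" for c
    unfolding field_def by measurable
  have single: "prob ((\<lambda>\<omega>. field \<omega> c) -` B \<inter> space M) = (\<Sum>v\<in>B. p v)" for c B
    using prob_cells[of "{c}" "\<lambda>_. B"] by (simp add: vimage_def Int_def conj_commute)
  have "prob (\<Inter>c\<in>J. A c) = (\<Prod>c\<in>J. prob (A c))"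
    if J: "J \<subseteq> I" "J \<noteq> {}" "finite J"
      and A: "\<forall>c\<in>J. A c \<in> {(\<lambda>\<omega>. field \<omega> c) -` B \<inter> space M | B. B \<in> sets (count_space UNIV)}"
    for J A
  proof -
    obtain B where B: "\<And>c. c \<in> J \<Longrightarrow> A c = (\<lambda>\<omega>. field \<omega> c) -` B c \<inter> space M"
      using bchoice[OF A[unfolded mem_Collect_eq]] by blast
    have "(\<Inter>c\<in>J. A c) = {\<omega> \<in> space M. \<forall>c\<in>J. field \<omega> c \<in> B c}"
      using B J(2) by auto
    then show ?thesis
      using prob_cells[of J B] J inj_on_subset[OF assms J(1)] by (simp add: B single)
  qed
  then have "indep_vars (\<lambda>_. count_space UNIV) (\<lambda>(k, n). X n k) I"
    unfolding indep_vars_def2 indep_sets_def Y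
    using meas by (auto simp: Pi_iff)
  moreover have "distr M (count_space UNIV) (\<lambda>\<omega>. field \<omega> c) = distr M (count_space UNIV) (\<lambda>\<omega>. field \<omega> d)"
    for c d
    by (rule measure_eqI) (simp_all add: emeasure_distr meas emeasure_eq_measure single)
  ultimately show ?thesis
    unfolding iid_vars_def Y by blast
qed

end

section \<open>Lines of the diagram\<close>

lemma straight_line_injective_coordinate:
  assumes "straight_line L"
  shows "inj_on fst L \<or> (\<forall>x\<in>L. \<forall>y\<in>L. fst x = fst y)"
proof -
  have "collinear L" using assms by (simp add: straight_line_def collinear_aff_dim)
  then obtain u where u: "\<And>x y. x \<in> L \<Longrightarrow> y \<in> L \<Longrightarrow> \<exists>a. x - y = a *\<^sub>R u"
    unfolding collinear_def by blast
  show ?thesis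
  proof (cases "fst u = 0")
    case True
    have "fst x = fst y" if "x \<in> L" "y \<in> L" for x y
      using u[OF that] True by (metis eq_iff_diff_eq_0 fst_diff fst_scaleR scaleR_zero_right)
    then show ?thesis by blast
  next
    case False
    have "x = y" if xy: "x \<in> L" "y \<in> L" "fst x = fst y" for x y
    proof -
      obtain a where a: "x - y = a *\<^sub>R u" using u[OF xy(1,2)] by blast
      then have "a * fst u = 0" using xy(3) by (metis diff_self fst_diff fst_scaleR real_scaleR_def)
      then show ?thesis using a False by simp
    qed
    then show ?thesis by (blast intro: inj_onI)
  qed
qed

theorem corollary5p9:
  fixes l :: nat
    and \<theta> :: "'a::finite \<Rightarrow> 'a list \<Rightarrow> real"
    and p :: "'a \<Rightarrow> real"
    and M :: "'w measure"
    and X :: "int \<Rightarrow> int \<Rightarrow> 'w \<Rightarrow> 'a"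
  assumes "l \<ge> 1"
    and "is_pca l \<theta>"
    and "\<And>i. p i > 0" and "(\<Sum>i\<in>UNIV. p i) = 1"
    and "\<And>w k. length w = l \<Longrightarrow> (\<Sum>i\<in>UNIV. p i * \<theta> k (w @ [i])) = p k"
    and "\<And>w k. length w = l \<Longrightarrow> (\<Sum>i\<in>UNIV. p i * \<theta> k (i # w)) = p k"
    and "stationary_space_time_diagram l \<theta> p M X"
  shows "(\<forall>L. straight_line L \<longrightarrow>
            iid_vars M (count_space UNIV) (\<lambda>(k, n). X n k)
              {(k, n). (real_of_int k, real_of_int n) \<in> L})
       \<and> (\<forall>k n k' n'. (k, n) \<noteq> (k', n') \<longrightarrow>
            prob_space.indep_var M (count_space UNIV) (X n k) (count_space UNIV) (X n' k'))"
proof -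
  interpret prob_space M
    using assms(7) by (simp add: stationary_space_time_diagram_def)
  interpret space_time_diagram M l \<theta> p X
    using assms by unfold_locales auto
  \<comment> \<open>Revealing the columns from right to left: the first letter of a word is at the height of the
    new cell.\<close>
  interpret left: height_function M l \<theta> p X "\<lambda>c. - fst c" 0
  proof
    fix w :: "'a list" and v
    assume "length w = Suc l"
    then obtain a w' where "w = a # w'" "length w' = l" by (cases w) auto
    then show "(\<Sum>u\<in>UNIV. p u * \<theta> v (w[0 := u])) = p v" using assms(6)[of w'] by simp
  qed auto
  \<comment> \<open>The height that is constant along the direction \<open>(-l, 1)\<close>, so that it is the last letter of
    a word which is level with the new cell.\<close>
  interpret right: height_function M l \<theta> p X "\<lambda>c. fst c + int l * snd c" l
  proof
    fix w :: "'a list" and v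
    assume "length w = Suc l"
    then obtain a w' where "w = w' @ [a]" "length w' = l"
      by (metis append_butlast_last_id diff_Suc_1 length_butlast length_greater_0_conv zero_less_Suc)
    then show "(\<Sum>u\<in>UNIV. p u * \<theta> v (w[l := u])) = p v" using assms(5)[of w'] by (simp add: list_update_append)
  qed (auto simp: algebra_simps)
  have iid: "iid_vars M (count_space UNIV) (\<lambda>(k, n). X n k) I"
    if "inj_on fst I \<or> (\<forall>c\<in>I. \<forall>d\<in>I. fst c = fst d)" for I
    using that
  proof
    assume "inj_on fst I"
    then show ?thesis by (intro left.iid_on_injective_heights) (auto simp: inj_on_def)
  next
    assume "\<forall>c\<in>I. \<forall>d\<in>I. fst c = fst d"
    moreover have "int l \<noteq> 0" using assms(1) by simp
    ultimately have "inj_on (\<lambda>c. fst c + int l * snd c) I"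
      by (intro inj_onI) (metis add_left_cancel mult_left_cancel prod_eqI)
    then show ?thesis by (rule right.iid_on_injective_heights)
  qed
  show ?thesis
  proof (intro conjI allI impI)
    fix L assume "straight_line L"
    from straight_line_injective_coordinate[OF this]
    show "iid_vars M (count_space UNIV) (\<lambda>(k, n). X n k)
            {(k, n). (real_of_int k, real_of_int n) \<in> L}"
    proof (intro iid, elim disj_forward)
      assume "inj_on fst L"
      then show "inj_on fst {(k, n). (real_of_int k, real_of_int n) \<in> L}"
        by (fastforce simp: inj_on_def)
    next
      assume "\<forall>x\<in>L. \<forall>y\<in>L. fst x = fst y"
      then show "\<forall>c\<in>{(k, n). (real_of_int k, real_of_int n) \<in> L}.
          \<forall>d\<in>{(k, n). (real_of_int k, real_of_int n) \<in> L}. fst c = fst d"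
        by fastforce
    qed
  next
    fix k n k' n' :: int
    assume ne: "(k, n) \<noteq> (k', n')"
    have "iid_vars M (count_space UNIV) (\<lambda>(k, n). X n k) {(k, n), (k', n')}"
      by (rule iid) (auto simp: inj_on_def)
    then have "indep_vars (\<lambda>_. count_space UNIV) (\<lambda>(k, n). X n k) {(k, n), (k', n')}"
      by (simp add: iid_vars_def)
    then have "indep_var (\<Pi>\<^sub>M c\<in>{(k, n)}. count_space UNIV) (\<lambda>\<omega>. \<lambda>c\<in>{(k, n)}. (case c of (k, n) \<Rightarrow> X n k) \<omega>)
        (\<Pi>\<^sub>M c\<in>{(k', n')}. count_space UNIV) (\<lambda>\<omega>. \<lambda>c\<in>{(k', n')}. (case c of (k, n) \<Rightarrow> X n k) \<omega>)"
      by (rule indep_var_restrict) (use ne in auto)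
    then have "indep_var (count_space UNIV)
          ((\<lambda>f. f (k, n)) \<circ> (\<lambda>\<omega>. \<lambda>c\<in>{(k, n)}. (case c of (k, n) \<Rightarrow> X n k) \<omega>))
        (count_space UNIV)
          ((\<lambda>f. f (k', n')) \<circ> (\<lambda>\<omega>. \<lambda>c\<in>{(k', n')}. (case c of (k, n) \<Rightarrow> X n k) \<omega>))"
      by (rule indep_var_compose) (auto intro!: measurable_component_singleton)
    then show "indep_var (count_space UNIV) (X n k) (count_space UNIV) (X n' k')"
      by (simp add: comp_def)
  qed
qed

end
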